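(* For every real $x$ with $0<x<\pi/2$, \begin{align*} 2+\left(\frac{2}{45}-\frac{2}{315}x^2-\alpha x^{4}\right)x^{3}\tan x&<\left(\frac{x}{\sin x}\right)^{2}+\frac{x}{\tan x}\\ &<2+\left(\frac{2}{45}-\frac{2}{315}x^2-\beta x^{4}\right)x^{3}\tan x, \end{align*} \begin{align*} 3+\left(\frac{3}{20}+\frac{1}{280}x^2+\lambda x^{4}\right)x^{3}\tan x&<2\left(\frac{\sin x}{x}\right)+\frac{\tan x}{x}\\ &<3+\left(\frac{3}{20}+\frac{1}{280}x^2+\mu x^{4}\right)x^{3}\tan x \end{align*} and \begin{align*} 3+\left(\frac{1}{60}-\frac{1}{280}x^2-\rho x^{4}\right)x^{3}\tan x&<2\left(\frac{x}{\sin x}\right)+\frac{x}{\tan x}\\ &<3+\left(\frac{1}{60}-\frac{1}{280}x^2-\varrho x^{4}\right)x^{3}\tan x, \end{align*} with the best possible constants $$\alpha=\frac{224-8\pi^2}{315\pi^4}=0.004727\ldots,\qquad \beta=\frac{4}{1575}=0.002539\ldots,$$ $$\lambda=\frac{23}{33600}=0.000684\ldots,\qquad \mu=\frac{17920-168\pi^4-\pi^6}{70\pi^8}=0.000894\ldots$$ and $$\rho=\frac{56-3\pi^2}{210\pi^4}=0.0012901\ldots,\qquad \varrho=\frac{83}{100800}=0.0008234\ldots.$$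
   Context: Here $\rho$ and $\varrho$ are two different constants. "Best possible constants" means that the inequalities hold for all $x\in(0,\pi/2)$ with the given constants, and that none of the constants can be improved: the inequality containing $\alpha$ (respectively $\rho$, $\mu$) fails for some $x\in(0,\pi/2)$ if that constant is replaced by any smaller real number, and the inequality containing $\beta$ (respectively $\varrho$, $\lambda$) fails for some $x\in(0,\pi/2)$ if that constant is replaced by any larger real number. *)

theory Defs
  imports Complex_Main
begin

text \<open>The predicate \<open>P c\<close> is meant to express that an inequality with parameter \<open>c\<close> holds
  on its whole domain; the constant is then best possible if \<open>P\<close> holds for it and fails
  for every smaller (respectively every larger) real number.\<close>

definition best_possible_below :: "(real \<Rightarrow> bool) \<Rightarrow> real \<Rightarrow> bool" where
  "best_possible_below P c \<longleftrightarrow> P c \<and> (\<forall>c'<c. \<not> P c')"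

definition best_possible_above :: "(real \<Rightarrow> bool) \<Rightarrow> real \<Rightarrow> bool" where
  "best_possible_above P c \<longleftrightarrow> P c \<and> (\<forall>c'>c. \<not> P c')"

end

theory Submission
  imports Defs "HOL-Real_Asymp.Real_Asymp"
begin

text \<open>Solving each pair of inequalities for its constant turns it into \<open>l < F x < m\<close> for a
  quotient \<open>F\<close> such as \<open>num1 x / (x^7 * sin x^3)\<close>, free of \<open>tan\<close> and therefore regular at
  \<open>pi/2\<close>. Each \<open>F\<close> is strictly increasing on \<open>(0, pi/2]\<close>, so the best constants are its limit
  at \<open>0\<close> and its value at \<open>pi/2\<close>. Up to a positive factor, the derivative of \<open>F\<close> is a
  trigonometric polynomial with rational coefficients whose power series, after
  division by \<open>x^12\<close> or \<open>x^13\<close>, alternates with rapidly decreasing terms; degree-19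
  Taylor polynomials of the multiple angles already certify its positivity on \<open>(0, 8/5]\<close>.\<close>

section \<open>Taylor polynomials and their errors\<close>

definition sin20 :: "real \<Rightarrow> real" where
  "sin20 y = y - y^3/6 + y^5/120 - y^7/5040 + y^9/362880 - y^11/39916800 + y^13/6227020800
    - y^15/1307674368000 + y^17/355687428096000 - y^19/121645100408832000"

text \<open>The degree is 18 only because odd coefficients vanish: like \<open>sin20\<close>, this
  is the truncation below \<open>y^20\<close>, so both have the same error bound.\<close>

definition cos20 :: "real \<Rightarrow> real" where
  "cos20 y = 1 - y^2/2 + y^4/24 - y^6/720 + y^8/40320 - y^10/3628800 + y^12/479001600
    - y^14/87178291200 + y^16/20922789888000 - y^18/6402373705728000"

lemma sin_minus_sin20: "\<bar>sin y - sin20 y\<bar> \<le> \<bar>y\<bar>^20 / fact 20"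
  using Maclaurin_sin_bound[of y 20]
  by (simp add: sin20_def lessThan_nat_numeral sin_coeff_def fact_numeral field_simps)

lemma cos_minus_cos20: "\<bar>cos y - cos20 y\<bar> \<le> \<bar>y\<bar>^20 / fact 20"
proof -
  obtain t where t: "cos y = (\<Sum>m<20. cos_coeff m * y^m) + cos (t + 1/2 * real 20 * pi) / fact 20 * y^20"
    using Maclaurin_cos_expansion[of y 20] by auto
  \<comment> \<open>The Lagrange remainder contains a shifted cosine, which is at most 1 in absolute
    value.\<close>
  have "\<bar>cos y - (\<Sum>m<20. cos_coeff m * y^m)\<bar> = \<bar>cos (t + 1/2 * real 20 * pi)\<bar> * \<bar>y\<bar>^20 / fact 20"
    unfolding t by (simp add: abs_mult power_abs)
  also have "\<dots> \<le> 1 * \<bar>y\<bar>^20 / fact 20"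
    by (intro divide_right_mono mult_right_mono) auto
  finally show ?thesis
    by (simp add: cos20_def lessThan_nat_numeral cos_coeff_def fact_numeral field_simps)
qed

text \<open>Bounding only \<open>x^(20 - m)\<close> by its value at \<open>8/5\<close> keeps a
  factor \<open>x^m\<close> in the error. With \<open>m\<close> the leading power of the main term,
  the comparison stays uniform down to \<open>x = 0\<close>.\<close>

lemma taylor20_error:
  fixes k x \<epsilon> :: real
  assumes "0 \<le> k" "0 < x" "x \<le> 8/5" "m \<le> 20" and \<epsilon>: "k^20 * (8/5)^(20 - m) / fact 20 \<le> \<epsilon>"
  shows "\<bar>sin (k * x) - sin20 (k * x)\<bar> \<le> \<epsilon> * x^m" "\<bar>cos (k * x) - cos20 (k * x)\<bar> \<le> \<epsilon> * x^m"
proof -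
  have "\<bar>k * x\<bar>^20 / fact 20 = k^20 / fact 20 * x^(20 - m) * x^m"
    using assms(1,2,4) by (simp add: power_mult_distrib flip: power_add)
  also have "\<dots> \<le> k^20 / fact 20 * (8/5)^(20 - m) * x^m"
    using assms by (intro mult_right_mono mult_left_mono power_mono) auto
  also have "\<dots> \<le> \<epsilon> * x^m"
    using \<epsilon> assms(2) by (intro mult_right_mono) (auto simp: field_simps)
  finally have "\<bar>k * x\<bar>^20 / fact 20 \<le> \<epsilon> * x^m" .
  then show "\<bar>sin (k * x) - sin20 (k * x)\<bar> \<le> \<epsilon> * x^m" "\<bar>cos (k * x) - cos20 (k * x)\<bar> \<le> \<epsilon> * x^m"
    using sin_minus_sin20[of "k * x"] cos_minus_cos20[of "k * x"] by linarith+
qed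

text \<open>Bounds from below each product of a polynomial coefficient with a Taylor error.\<close>

lemma abs_mult_lower:
  fixes a b A B :: real
  assumes "\<bar>a\<bar> \<le> A" "\<bar>b\<bar> \<le> B"
  shows "- (A * B) \<le> a * b"
proof -
  have "\<bar>a * b\<bar> \<le> A * B"
    unfolding abs_mult using assms by (intro mult_mono) auto
  then show ?thesis
    by linarith
qed

section \<open>Multiple angles\<close>

lemma sin_multiples:
  fixes x :: real
  shows "sin (2 * x) = 2 * sin x * cos x"
    and "sin (3 * x) = 3 * sin x - 4 * sin x^3"
    and "sin (4 * x) = 4 * sin x * cos x - 8 * sin x^3 * cos x"
proof -
  show s2: "sin (2 * x) = 2 * sin x * cos x"
    by (rule sin_double)
  have "sin (3 * x) = sin (2 * x + x)"
    by simp
  also have "\<dots> = 3 * sin x - 4 * sin x^3"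
    unfolding sin_add sin_double cos_double using sin_cos_squared_add3[of x] by algebra
  finally show "sin (3 * x) = 3 * sin x - 4 * sin x^3" .
  have "sin (4 * x) = sin (2 * (2 * x))"
    by simp
  also have "\<dots> = 4 * sin x * cos x - 8 * sin x^3 * cos x"
    unfolding sin_double cos_double_sin by algebra
  finally show "sin (4 * x) = 4 * sin x * cos x - 8 * sin x^3 * cos x" .
qed

lemma cos_multiples:
  fixes x :: real
  shows "cos (2 * x) = 1 - 2 * sin x^2"
    and "cos (3 * x) = cos x - 4 * sin x^2 * cos x"
    and "cos (4 * x) = 1 - 8 * sin x^2 * cos x^2"
proof -
  show "cos (2 * x) = 1 - 2 * sin x^2"
    by (rule cos_double_sin)
  have "cos (3 * x) = cos (2 * x + x)"
    by simp
  also have "\<dots> = cos x - 4 * sin x^2 * cos x"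
    unfolding cos_add sin_double cos_double using sin_cos_squared_add3[of x] by algebra
  finally show "cos (3 * x) = cos x - 4 * sin x^2 * cos x" .
  show "cos (4 * x) = 1 - 8 * sin x^2 * cos x^2"
    using cos_double_sin[of "2 * x"] unfolding sin_double by (simp add: power_mult_distrib)
qed

section \<open>Numerators of the quotients and their derivatives\<close>

text \<open>The polynomial side minus the trigonometric side at parameter 0, multiplied by
  \<open>sin x^2 * cos x\<close>. For \<open>num3\<close> the factor is
  \<open>sin x * cos x\<close>; \<open>num2\<close> is the opposite difference, multiplied by
  \<open>x * cos x\<close>.\<close>

definition num1 :: "real \<Rightarrow> real" where
  "num1 x = (2/45*x^3 - 2/315*x^5) * sin x^3 + 2*sin x^2*cos x - x^2*cos x - x*sin x*cos x^2"

definition dnum1 :: "real \<Rightarrow> real" where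
  "dnum1 x = (2/15*x^2 - 2/63*x^4) * sin x^3 + (2/45*x^3 - 2/315*x^5) * (3*sin x^2*cos x)
    + 4*sin x*cos x^2 - 2*sin x^3 - 2*x*cos x + x^2*sin x - sin x*cos x^2 - x*cos x^3 + 2*x*sin x^2*cos x"

definition num2 :: "real \<Rightarrow> real" where
  "num2 x = 2*sin x*cos x + sin x - 3*x*cos x - (3/20*x^4 + 1/280*x^6)*sin x"

definition dnum2 :: "real \<Rightarrow> real" where
  "dnum2 x = 2*cos x^2 - 2*sin x^2 - 2*cos x + 3*x*sin x - (3/5*x^3 + 3/140*x^5)*sin x
    - (3/20*x^4 + 1/280*x^6)*cos x"

definition num3 :: "real \<Rightarrow> real" where
  "num3 x = 3*sin x*cos x + (1/60*x^3 - 1/280*x^5)*sin x^2 - 2*x*cos x - x*cos x^2"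

definition dnum3 :: "real \<Rightarrow> real" where
  "dnum3 x = 3*cos x^2 - 3*sin x^2 + (1/20*x^2 - 1/56*x^4)*sin x^2
    + (1/60*x^3 - 1/280*x^5)*(2*sin x*cos x) - 2*cos x + 2*x*sin x - cos x^2 + 2*x*sin x*cos x"

lemma num1_deriv: "(num1 has_real_derivative dnum1 x) (at x)"
  unfolding num1_def dnum1_def
  by (auto intro!: derivative_eq_intros) algebra

lemma num2_deriv: "(num2 has_real_derivative dnum2 x) (at x)"
  unfolding num2_def dnum2_def
  by (auto intro!: derivative_eq_intros) algebra

lemma num3_deriv: "(num3 has_real_derivative dnum3 x) (at x)"
  unfolding num3_def dnum3_def
  by (auto intro!: derivative_eq_intros) algebra

section \<open>Positivity of the derivatives\<close>

text \<open>This is the numerator of the derivative of \<open>num1 x / (x^7 * sin x^3)\<close>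
  without its factor \<open>x^6 * sin x^2\<close>. Written linearly in sines and cosines of
  \<open>2*x\<close> and \<open>4*x\<close>, it loses all powers below \<open>x^13\<close> once the
  Taylor polynomials are inserted.\<close>

lemma num1_deriv_pos:
  fixes x :: real
  assumes x: "0 < x" "x \<le> 8/5"
  shows "0 < x * sin x * dnum1 x - num1 x * (7 * sin x + 3 * x * cos x)"
proof -
  define ec2 where "ec2 = cos (2*x) - cos20 (2*x)"
  define ec4 where "ec4 = cos (4*x) - cos20 (4*x)"
  define es2 where "es2 = sin (2*x) - sin20 (2*x)"
  define es4 where "es4 = sin (4*x) - sin20 (4*x)"
  have err: "\<bar>ec2\<bar> \<le> 1/10000000 * x^13" "\<bar>ec4\<bar> \<le> 13/1000000 * x^13"
      "\<bar>es2\<bar> \<le> 1/10000000 * x^13" "\<bar>es4\<bar> \<le> 13/1000000 * x^13"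
    using x taylor20_error[of 2 x 13 "1/10000000"] taylor20_error[of 4 x 13 "13/1000000"]
    unfolding ec2_def ec4_def es2_def es4_def by (simp_all add: power_divide fact_numeral)
  have pow: "0 \<le> x^2" "x^2 \<le> 64/25" "0 \<le> x^3" "x^3 \<le> 512/125" "0 \<le> x^5"
      "x^5 \<le> 32768/3125"
    using x power_mono[of x "8/5" 2] power_mono[of x "8/5" 3] power_mono[of x "8/5" 5]
    by (simp_all add: power_divide)
  have coeff: "\<bar>(x + 49/45*x^3 - 2/315*x^5)\<bar> \<le> 7"
      "\<bar>(-3/4*x - 1/45*x^3 + 1/630*x^5)\<bar> \<le> 2"
      "\<bar>(-7/2 + 7/2*x^2)\<bar> \<le> 13"
      "\<bar>(7/4) :: real\<bar> \<le> 2"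
    using x pow by linarith+
  have "x * sin x * dnum1 x - num1 x * (7 * sin x + 3 * x * cos x)
    = -1/4*x + 29/15*x^3 + 1/210*x^5
      + (x + 49/45*x^3 - 2/315*x^5) * cos (2*x)
      + (-3/4*x - 1/45*x^3 + 1/630*x^5) * cos (4*x)
      + (-7/2 + 7/2*x^2) * sin (2*x)
      + (7/4) * sin (4*x)"
    unfolding sin_multiples cos_multiples num1_def dnum1_def using sin_cos_squared_add3[of x]
    by algebra
  \<comment> \<open>Terms are paired so that each difference is nonnegative for
    \<open>x^2 \<le> 64/25\<close>; the first is at least \<open>17/100000\<close>, while the errors
    total less than \<open>6/100000\<close>.\<close>
  also have "\<dots> = x^13 * ((20/18711 - 31832/91216125*x^2)
        + x^4 * (4948/91216125 - 200936/37574026875*x^2)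
        + x^8 * (109975748/194896477400625 - 2056/120678933375*x^2))
      + (x + 49/45*x^3 - 2/315*x^5) * ec2
      + (-3/4*x - 1/45*x^3 + 1/630*x^5) * ec4
      + (-7/2 + 7/2*x^2) * es2
      + (7/4) * es4"
    unfolding ec2_def ec4_def es2_def es4_def sin20_def cos20_def by algebra
  finally have eq: "x * sin x * dnum1 x - num1 x * (7 * sin x + 3 * x * cos x) = \<dots>" .
  have sq: "0 \<le> x^2" "x^2 \<le> 64/25"
    using x power_mono[of x "8/5" 2] by (auto simp: power_divide)
  \<comment> \<open>The summands \<open>0\<close> and the split minus signs align both sides for \<open>add_mono\<close>.\<close>
  have "0 < x^13 * (17/100000 + 0 + 0) + - (7 * (1/10000000 * x^13))
      + - (2 * (13/1000000 * x^13)) + - (13 * (1/10000000 * x^13))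
      + - (2 * (13/1000000 * x^13))"
    using zero_less_power[OF x(1), of 13] by simp
  also have "\<dots> \<le> x^13 * ((20/18711 - 31832/91216125*x^2)
        + x^4 * (4948/91216125 - 200936/37574026875*x^2)
        + x^8 * (109975748/194896477400625 - 2056/120678933375*x^2))
      + (x + 49/45*x^3 - 2/315*x^5) * ec2
      + (-3/4*x - 1/45*x^3 + 1/630*x^5) * ec4
      + (-7/2 + 7/2*x^2) * es2
      + (7/4) * es4"
    using sq x by (intro add_mono mult_left_mono mult_nonneg_nonneg abs_mult_lower coeff err) simp_all
  finally show ?thesis
    unfolding eq .
qed

text \<open>As for \<open>num1\<close>, with denominator \<open>x^8 * sin x\<close>, angles up to
  \<open>3*x\<close> and leading power \<open>x^12\<close>.\<close>

lemma num2_deriv_pos: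
  fixes x :: real
  assumes x: "0 < x" "x \<le> 8/5"
  shows "0 < x * sin x * dnum2 x - num2 x * (8 * sin x + x * cos x)"
proof -
  define ec1 where "ec1 = cos x - cos20 x"
  define ec2 where "ec2 = cos (2*x) - cos20 (2*x)"
  define ec3 where "ec3 = cos (3*x) - cos20 (3*x)"
  define es1 where "es1 = sin x - sin20 x"
  define es2 where "es2 = sin (2*x) - sin20 (2*x)"
  define es3 where "es3 = sin (3*x) - sin20 (3*x)"
  have err: "\<bar>ec1\<bar> \<le> 1/10000000 * x^12" "\<bar>ec2\<bar> \<le> 1/10000000 * x^12"
      "\<bar>ec3\<bar> \<le> 1/10000000 * x^12" "\<bar>es1\<bar> \<le> 1/10000000 * x^12"
      "\<bar>es2\<bar> \<le> 1/10000000 * x^12" "\<bar>es3\<bar> \<le> 1/10000000 * x^12"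
    using x taylor20_error[of 1 x 12 "1/10000000"] taylor20_error[of 2 x 12 "1/10000000"]
        taylor20_error[of 3 x 12 "1/10000000"]
    unfolding ec1_def ec2_def ec3_def es1_def es2_def es3_def
    by (simp_all add: power_divide fact_numeral)
  have pow: "0 \<le> x^4" "x^4 \<le> 4096/625" "0 \<le> x^6" "x^6 \<le> 262144/15625"
    using x power_mono[of x "8/5" 4] power_mono[of x "8/5" 6] by (simp_all add: power_divide)
  have coeff: "\<bar>(-4) :: real\<bar> \<le> 4"
      "\<bar>(4 - 3/10*x^4 - 1/280*x^6)\<bar> \<le> 7"
      "\<bar>4 :: real\<bar> \<le> 4"
      "\<bar>(-3/2*x)\<bar> \<le> 3"
      "\<bar>(21/2*x)\<bar> \<le> 17"
      "\<bar>(1/2*x)\<bar> \<le> 1"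
    using x pow by linarith+
  have "x * sin x * dnum2 x - num2 x * (8 * sin x + x * cos x)
    = -4 + 3*x^2 + 3/10*x^4 + 1/280*x^6
      + (-4) * cos x
      + (4 - 3/10*x^4 - 1/280*x^6) * cos (2*x)
      + 4 * cos (3*x)
      + (-3/2*x) * sin x
      + (21/2*x) * sin (2*x)
      + (1/2*x) * sin (3*x)"
    unfolding sin_multiples cos_multiples num2_def dnum2_def using sin_cos_squared_add3[of x]
    by algebra
  \<comment> \<open>Truncation leaves the coefficients from \<open>x^20\<close> on incomplete, so
    the signs no longer alternate: the positive coefficient of \<open>x^16\<close> has to absorb two
    negative ones, hence the extra bound on \<open>x^4\<close>.\<close>
  also have "\<dots> = x^12 * ((47/369600 - 49639/3027024000*x^2)
        + x^4 * (33967/36324288000 - 229457/7410154752000*x^2 - 1806277531/354798209525760000*x^4)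
        + x^10 * (1/911796385500 + 1/6838472891250*x^2))
      + (-4) * ec1
      + (4 - 3/10*x^4 - 1/280*x^6) * ec2
      + 4 * ec3
      + (-3/2*x) * es1
      + (21/2*x) * es2
      + (1/2*x) * es3"
    unfolding ec1_def ec2_def ec3_def es1_def es2_def es3_def sin20_def cos20_def by algebra
  finally have eq: "x * sin x * dnum2 x - num2 x * (8 * sin x + x * cos x) = \<dots>" .
  have sq: "0 \<le> x^2" "x^2 \<le> 64/25"
    using x power_mono[of x "8/5" 2] by (auto simp: power_divide)
  have sq4: "0 \<le> x^4" "x^4 \<le> 4096/625"
    using x power_mono[of x "8/5" 4] by (auto simp: power_divide)
  have "0 < x^12 * (1/12500 + 0 + 0) + - (4 * (1/10000000 * x^12))
      + - (7 * (1/10000000 * x^12)) + - (4 * (1/10000000 * x^12)) + - (3 * (1/10000000 * x^12))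
      + - (17 * (1/10000000 * x^12)) + - (1 * (1/10000000 * x^12))"
    using zero_less_power[OF x(1), of 12] by simp
  also have "\<dots> \<le> x^12 * ((47/369600 - 49639/3027024000*x^2)
        + x^4 * (33967/36324288000 - 229457/7410154752000*x^2 - 1806277531/354798209525760000*x^4)
        + x^10 * (1/911796385500 + 1/6838472891250*x^2))
      + (-4) * ec1
      + (4 - 3/10*x^4 - 1/280*x^6) * ec2
      + 4 * ec3
      + (-3/2*x) * es1
      + (21/2*x) * es2
      + (1/2*x) * es3"
    using sq sq4 x by (intro add_mono mult_left_mono mult_nonneg_nonneg abs_mult_lower coeff err) simp_all
  finally show ?thesis
    unfolding eq .
qed

text \<open>The same argument with denominator \<open>x^7 * sin x^2\<close>; the leading power is
  again \<open>x^12\<close>.\<close>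

lemma num3_deriv_pos:
  fixes x :: real
  assumes x: "0 < x" "x \<le> 8/5"
  shows "0 < x * sin x * dnum3 x - num3 x * (7 * sin x + 2 * x * cos x)"
proof -
  define ec1 where "ec1 = cos x - cos20 x"
  define ec2 where "ec2 = cos (2*x) - cos20 (2*x)"
  define ec3 where "ec3 = cos (3*x) - cos20 (3*x)"
  define es1 where "es1 = sin x - sin20 x"
  define es2 where "es2 = sin (2*x) - sin20 (2*x)"
  define es3 where "es3 = sin (3*x) - sin20 (3*x)"
  have err: "\<bar>ec1\<bar> \<le> 1/10000000 * x^12" "\<bar>ec2\<bar> \<le> 1/10000000 * x^12"
      "\<bar>ec3\<bar> \<le> 1/10000000 * x^12" "\<bar>es1\<bar> \<le> 1/10000000 * x^12"
      "\<bar>es2\<bar> \<le> 1/10000000 * x^12" "\<bar>es3\<bar> \<le> 1/10000000 * x^12"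
    using x taylor20_error[of 1 x 12 "1/10000000"] taylor20_error[of 2 x 12 "1/10000000"]
        taylor20_error[of 3 x 12 "1/10000000"]
    unfolding ec1_def ec2_def ec3_def es1_def es2_def es3_def
    by (simp_all add: power_divide fact_numeral)
  have pow: "0 \<le> x^2" "x^2 \<le> 64/25" "0 \<le> x^3" "x^3 \<le> 512/125" "0 \<le> x^5"
      "x^5 \<le> 32768/3125"
    using x power_mono[of x "8/5" 2] power_mono[of x "8/5" 3] power_mono[of x "8/5" 5]
    by (simp_all add: power_divide)
  have coeff: "\<bar>(-21/4 + 2*x^2)\<bar> \<le> 11"
      "\<bar>x^2\<bar> \<le> 3"
      "\<bar>(21/4) :: real\<bar> \<le> 6"
      "\<bar>(-3/2*x - 1/20*x^3 + 3/560*x^5)\<bar> \<le> 3"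
      "\<bar>6*x\<bar> \<le> 10"
      "\<bar>(3/2*x + 1/60*x^3 - 1/560*x^5)\<bar> \<le> 3"
    using x pow by linarith+
  have "x * sin x * dnum3 x - num3 x * (7 * sin x + 2 * x * cos x)
    = 3*x^2
      + (-21/4 + 2*x^2) * cos x
      + x^2 * cos (2*x)
      + (21/4) * cos (3*x)
      + (-3/2*x - 1/20*x^3 + 3/560*x^5) * sin x
      + 6*x * sin (2*x)
      + (3/2*x + 1/60*x^3 - 1/560*x^5) * sin (3*x)"
    unfolding sin_multiples cos_multiples num3_def dnum3_def using sin_cos_squared_add3[of x]
    by algebra
  also have "\<dots> = x^12 * ((509/1995840 - 8279/141891750*x^2)
        + x^4 * (337583/54486432000 - 135989837/333456963840000*x^2)
        + x^8 * (5320537249/473064279367680000 - 90483073/112041539850240000*x^2)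
        + x^12 * (28009/1641634283520000))
      + (-21/4 + 2*x^2) * ec1
      + x^2 * ec2
      + (21/4) * ec3
      + (-3/2*x - 1/20*x^3 + 3/560*x^5) * es1
      + 6*x * es2
      + (3/2*x + 1/60*x^3 - 1/560*x^5) * es3"
    unfolding ec1_def ec2_def ec3_def es1_def es2_def es3_def sin20_def cos20_def by algebra
  finally have eq: "x * sin x * dnum3 x - num3 x * (7 * sin x + 2 * x * cos x) = \<dots>" .
  have sq: "0 \<le> x^2" "x^2 \<le> 64/25"
    using x power_mono[of x "8/5" 2] by (auto simp: power_divide)
  have "0 < x^12 * (1/10000 + 0 + 0 + 0) + - (11 * (1/10000000 * x^12))
      + - (3 * (1/10000000 * x^12)) + - (6 * (1/10000000 * x^12)) + - (3 * (1/10000000 * x^12))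
      + - (10 * (1/10000000 * x^12)) + - (3 * (1/10000000 * x^12))"
    using zero_less_power[OF x(1), of 12] by simp
  also have "\<dots> \<le> x^12 * ((509/1995840 - 8279/141891750*x^2)
        + x^4 * (337583/54486432000 - 135989837/333456963840000*x^2)
        + x^8 * (5320537249/473064279367680000 - 90483073/112041539850240000*x^2)
        + x^12 * (28009/1641634283520000))
      + (-21/4 + 2*x^2) * ec1
      + x^2 * ec2
      + (21/4) * ec3
      + (-3/2*x - 1/20*x^3 + 3/560*x^5) * es1
      + 6*x * es2
      + (3/2*x + 1/60*x^3 - 1/560*x^5) * es3"
    using sq x by (intro add_mono mult_left_mono mult_nonneg_nonneg abs_mult_lower coeff err) simp_all
  finally show ?thesis
    unfolding eq .
qed

section \<open>Best constants of an increasing function\<close>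

text \<open>Strict monotonicity up to and including \<open>b\<close> makes \<open>f b\<close> and
  \<open>L\<close> strict bounds on the open interval; continuity at \<open>b\<close> and the limit
  at 0 make them sharp.\<close>

lemma best_possible_increasing:
  fixes f :: "real \<Rightarrow> real"
  assumes "0 < b"
    and deriv: "\<And>x. 0 < x \<Longrightarrow> x \<le> b \<Longrightarrow> \<exists>d>0. (f has_real_derivative d) (at x)"
    and lim: "(f \<longlongrightarrow> L) (at_right 0)"
  shows "best_possible_below (\<lambda>a. \<forall>x. 0 < x \<and> x < b \<longrightarrow> f x < a) (f b)"
    and "best_possible_above (\<lambda>a. \<forall>x. 0 < x \<and> x < b \<longrightarrow> a < f x) L"
proof -
  have mono: "f x < f y" if "0 < x" "x < y" "y \<le> b" for x y
    using that(2)
  proof (rule DERIV_pos_imp_increasing)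
    show "\<exists>d. (f has_real_derivative d) (at z) \<and> 0 < d" if "x \<le> z" "z \<le> y" for z
      using deriv[of z] that \<open>0 < x\<close> \<open>y \<le> b\<close> by auto
  qed
  have "L < f x" if "0 < x" "x \<le> b" for x
  proof -
    \<comment> \<open>The limit alone gives a weak inequality; the intermediate point
      \<open>x/2\<close> makes it strict.\<close>
    have "L \<le> f (x/2)"
      using lim
    proof (rule tendsto_upperbound)
      show "\<forall>\<^sub>F y in at_right 0. f y \<le> f (x/2)"
        using that by (auto simp: eventually_at_right[of 0 "x/2"] intro!: exI[of _ "x/2"] less_imp_le[OF mono])
    qed simp
    also have "\<dots> < f x"
      using that by (intro mono) auto
    finally show ?thesis .
  qed
  moreover have "\<exists>x. 0 < x \<and> x < b \<and> \<not> a < f x" if "L < a" for a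
  proof -
    have "\<forall>\<^sub>F x in at_right 0. f x < a"
      using lim that by (rule order_tendstoD)
    then have "\<forall>\<^sub>F x in at_right 0. f x < a \<and> 0 < x \<and> x < b"
      using eventually_at_right_real[OF \<open>0 < b\<close>] by eventually_elim simp
    then obtain x where "f x < a" "0 < x" "x < b"
      using eventually_happens'[OF trivial_limit_at_right_real] by blast
    then show ?thesis
      by auto
  qed
  ultimately show "best_possible_above (\<lambda>a. \<forall>x. 0 < x \<and> x < b \<longrightarrow> a < f x) L"
    unfolding best_possible_above_def by fastforce
  have "\<exists>x. 0 < x \<and> x < b \<and> \<not> f x < a" if "a < f b" for a
  proof -
    \<comment> \<open>Differentiability is assumed at \<open>b\<close> too, so values just left of
      \<open>b\<close> exceed any \<open>a < f b\<close>.\<close>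
    have "isCont f b"
      using deriv[of b] \<open>0 < b\<close> DERIV_isCont by blast
    then have "(f \<longlongrightarrow> f b) (at_left b)"
      by (auto simp: isCont_def intro: tendsto_mono[OF at_le])
    then have "\<forall>\<^sub>F x in at_left b. a < f x"
      using that by (rule order_tendstoD)
    then have "\<forall>\<^sub>F x in at_left b. a < f x \<and> 0 < x \<and> x < b"
      using eventually_at_left_real[OF \<open>0 < b\<close>] by eventually_elim simp
    then obtain x where "a < f x" "0 < x" "x < b"
      using eventually_happens'[OF trivial_limit_at_left_real] by blast
    then show ?thesis
      by auto
  qed
  then show "best_possible_below (\<lambda>a. \<forall>x. 0 < x \<and> x < b \<longrightarrow> f x < a) (f b)"
    unfolding best_possible_below_def using mono by fastforce
qed

section \<open>Rational enclosure of pi\<close>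

text \<open>Half of the approximations \<open>2108/671 < pi < 355/113\<close> from the continued fraction of \<open>pi\<close>: sharp
  enough for the stated decimals, with small enough denominators to evaluate \<open>cos20\<close> exactly.\<close>
lemma pi_half_bounds: "1054/671 < pi/2" "pi/2 < 355/226"
proof -
  let ?a = "1054/671 :: real" and ?b = "355/226 :: real"
  \<comment> \<open>The sign change of cosine locates \<open>pi/2\<close>; the Taylor error is small
    enough to decide both signs.\<close>
  have "\<bar>cos ?a - cos20 ?a\<bar> \<le> 1/10^9" "\<bar>cos ?b - cos20 ?b\<bar> \<le> 1/10^9"
    using cos_minus_cos20[of ?a] cos_minus_cos20[of ?b] by (simp_all add: fact_numeral power_divide)
  moreover have "1/10^9 < cos20 ?a" "cos20 ?b < - (1/10^9)"
    by (simp_all add: cos20_def power_divide)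
  ultimately have a: "0 < cos ?a" and b: "cos ?b < 0"
    by linarith+
  show "?a < pi/2"
    using cos_monotone_0_pi_le[of "pi/2" ?a] pi_ge_two a by (intro not_le_imp_less notI) auto
  show "pi/2 < ?b"
    using cos_ge_zero[of ?b] b by (intro not_le_imp_less notI) auto
qed

section \<open>Monotonicity and best constants of the three quotients\<close>

text \<open>The quotient rule's numerator is the expression in \<open>pos\<close> times
  \<open>x^m * sin x^k\<close>, which is positive since \<open>0 < x \<le> pi/2\<close>. Successor
  exponents avoid subtraction in the derivatives of the powers.\<close>

lemma quotient_deriv_pos:
  fixes f :: "real \<Rightarrow> real"
  assumes "(f has_real_derivative f') (at x)" "0 < x" "x \<le> pi/2"
    and pos: "0 < x * sin x * f' - f x * (real (Suc m) * sin x + real (Suc k) * x * cos x)"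
  shows "\<exists>d>0. ((\<lambda>x. f x / (x^Suc m * sin x^Suc k)) has_real_derivative d) (at x)"
proof -
  have s: "0 < sin x"
    using assms(2,3) by (intro sin_gt_zero) (auto intro: le_less_trans)
  let ?g = "\<lambda>x. x^Suc m * sin x^Suc k"
  let ?g' = "x^m * sin x^k * (real (Suc m) * sin x + real (Suc k) * x * cos x)"
  have "(?g has_real_derivative ?g') (at x)"
    by (rule derivative_eq_intros refl | simp)+ (simp add: algebra_simps)
  then have "((\<lambda>x. f x / ?g x) has_real_derivative (f' * ?g x - f x * ?g') / (?g x * ?g x)) (at x)"
    using assms(1,2) s by (intro DERIV_divide) auto
  moreover have "f' * ?g x - f x * ?g'
      = x^m * sin x^k * (x * sin x * f' - f x * (real (Suc m) * sin x + real (Suc k) * x * cos x))"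
    by (simp add: algebra_simps)
  then have "0 < (f' * ?g x - f x * ?g') / (?g x * ?g x)"
    using s assms(2) pos by (simp del: power_Suc of_nat_Suc)
  ultimately show ?thesis
    by blast
qed

lemma pi_half_le: "x \<le> pi/2 \<Longrightarrow> x \<le> 8/5"
  using pi_half_bounds by simp

lemma best_possible_quotient1:
  shows "best_possible_below (\<lambda>a. \<forall>x. 0 < x \<and> x < pi/2 \<longrightarrow> num1 x / (x^7 * sin x^3) < a)
      (num1 (pi/2) / ((pi/2)^7 * sin (pi/2)^3))"
    and "best_possible_above (\<lambda>a. \<forall>x. 0 < x \<and> x < pi/2 \<longrightarrow> a < num1 x / (x^7 * sin x^3)) (4/1575)"
proof -
  have deriv: "\<exists>d>0. ((\<lambda>x. num1 x / (x^7 * sin x^3)) has_real_derivative d) (at x)"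
    if "0 < x" "x \<le> pi/2" for x
    \<comment> \<open>The arguments 6 and 2 are one less than the exponents 7 and 3.\<close>
    using quotient_deriv_pos[OF num1_deriv that, of 6 2] num1_deriv_pos[OF that(1) pi_half_le[OF that(2)]]
    by (simp del: power_Suc)
  \<comment> \<open>The limit is the leading Taylor coefficient of \<open>num1\<close>, which
    vanishes to order 10 at 0.\<close>
  have lim: "((\<lambda>x. num1 x / (x^7 * sin x^3)) \<longlongrightarrow> 4/1575) (at_right 0)"
    unfolding num1_def by real_asymp
  show "best_possible_below (\<lambda>a. \<forall>x. 0 < x \<and> x < pi/2 \<longrightarrow> num1 x / (x^7 * sin x^3) < a)
      (num1 (pi/2) / ((pi/2)^7 * sin (pi/2)^3))"
    and "best_possible_above (\<lambda>a. \<forall>x. 0 < x \<and> x < pi/2 \<longrightarrow> a < num1 x / (x^7 * sin x^3)) (4/1575)"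
    using best_possible_increasing[OF pi_half_gt_zero deriv lim] by simp_all
qed

lemma best_possible_quotient2:
  shows "best_possible_below (\<lambda>a. \<forall>x. 0 < x \<and> x < pi/2 \<longrightarrow> num2 x / (x^8 * sin x) < a)
      (num2 (pi/2) / ((pi/2)^8 * sin (pi/2)))"
    and "best_possible_above (\<lambda>a. \<forall>x. 0 < x \<and> x < pi/2 \<longrightarrow> a < num2 x / (x^8 * sin x)) (23/33600)"
proof -
  have deriv: "\<exists>d>0. ((\<lambda>x. num2 x / (x^8 * sin x)) has_real_derivative d) (at x)"
    if "0 < x" "x \<le> pi/2" for x
    using quotient_deriv_pos[OF num2_deriv that, of 7 0] num2_deriv_pos[OF that(1) pi_half_le[OF that(2)]]
    by (simp del: power_Suc)
  \<comment> \<open>Here, as for \<open>num3\<close>, the numerator vanishes to order 9.\<close>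
  have lim: "((\<lambda>x. num2 x / (x^8 * sin x)) \<longlongrightarrow> 23/33600) (at_right 0)"
    unfolding num2_def by real_asymp
  show "best_possible_below (\<lambda>a. \<forall>x. 0 < x \<and> x < pi/2 \<longrightarrow> num2 x / (x^8 * sin x) < a)
      (num2 (pi/2) / ((pi/2)^8 * sin (pi/2)))"
    and "best_possible_above (\<lambda>a. \<forall>x. 0 < x \<and> x < pi/2 \<longrightarrow> a < num2 x / (x^8 * sin x)) (23/33600)"
    using best_possible_increasing[OF pi_half_gt_zero deriv lim] by simp_all
qed

lemma best_possible_quotient3:
  shows "best_possible_below (\<lambda>a. \<forall>x. 0 < x \<and> x < pi/2 \<longrightarrow> num3 x / (x^7 * sin x^2) < a)
      (num3 (pi/2) / ((pi/2)^7 * sin (pi/2)^2))"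
    and "best_possible_above (\<lambda>a. \<forall>x. 0 < x \<and> x < pi/2 \<longrightarrow> a < num3 x / (x^7 * sin x^2)) (83/100800)"
proof -
  have deriv: "\<exists>d>0. ((\<lambda>x. num3 x / (x^7 * sin x^2)) has_real_derivative d) (at x)"
    if "0 < x" "x \<le> pi/2" for x
    using quotient_deriv_pos[OF num3_deriv that, of 6 1] num3_deriv_pos[OF that(1) pi_half_le[OF that(2)]]
    by (simp add: numeral_2_eq_2 del: power_Suc)
  have lim: "((\<lambda>x. num3 x / (x^7 * sin x^2)) \<longlongrightarrow> 83/100800) (at_right 0)"
    unfolding num3_def by real_asymp
  show "best_possible_below (\<lambda>a. \<forall>x. 0 < x \<and> x < pi/2 \<longrightarrow> num3 x / (x^7 * sin x^2) < a)
      (num3 (pi/2) / ((pi/2)^7 * sin (pi/2)^2))"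
    and "best_possible_above (\<lambda>a. \<forall>x. 0 < x \<and> x < pi/2 \<longrightarrow> a < num3 x / (x^7 * sin x^2)) (83/100800)"
    using best_possible_increasing[OF pi_half_gt_zero deriv lim] by simp_all
qed

section \<open>From the inequalities to the quotients\<close>

lemma less_iff_if_diff_eq_mult:
  fixes p q c d w :: real
  assumes "q - p = (c - d) * w" "0 < w"
  shows "p < q \<longleftrightarrow> d < c" "q < p \<longleftrightarrow> c < d"
proof -
  have "p < q \<longleftrightarrow> 0 < (c - d) * w" "q < p \<longleftrightarrow> (c - d) * w < 0"
    using assms(1) by linarith+
  then show "p < q \<longleftrightarrow> d < c" "q < p \<longleftrightarrow> c < d"
    using assms(2) by (simp_all add: zero_less_mult_iff mult_less_0_iff)
qed

text \<open>The parameter enters linearly with coefficient \<open>x^7 * tan x\<close>, positive on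
  the interval, so comparing the two sides amounts to comparing \<open>a\<close> with the
  quotient.\<close>

lemma inequality1_iff:
  fixes x a :: real
  assumes x: "0 < x" "x < pi/2"
  shows "2 + (2/45 - 2/315 * x^2 - a * x^4) * x^3 * tan x < (x / sin x)^2 + x / tan x
      \<longleftrightarrow> num1 x / (x^7 * sin x^3) < a"
    and "(x / sin x)^2 + x / tan x < 2 + (2/45 - 2/315 * x^2 - a * x^4) * x^3 * tan x
      \<longleftrightarrow> a < num1 x / (x^7 * sin x^3)"
proof -
  have s: "0 < sin x" and c: "0 < cos x"
    using x by (auto intro: sin_gt_zero2 cos_gt_zero)
  have eq: "(x / sin x)^2 + x / tan x - (2 + (2/45 - 2/315 * x^2 - a * x^4) * x^3 * tan x)
      = (a - num1 x / (x^7 * sin x^3)) * (x^7 * sin x / cos x)"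
    unfolding tan_def num1_def using x(1) s c
    by (simp add: divide_simps) algebra
  have w: "0 < x^7 * sin x / cos x"
    using x(1) s c by simp
  show "2 + (2/45 - 2/315 * x^2 - a * x^4) * x^3 * tan x < (x / sin x)^2 + x / tan x
      \<longleftrightarrow> num1 x / (x^7 * sin x^3) < a"
    and "(x / sin x)^2 + x / tan x < 2 + (2/45 - 2/315 * x^2 - a * x^4) * x^3 * tan x
      \<longleftrightarrow> a < num1 x / (x^7 * sin x^3)"
    by (rule less_iff_if_diff_eq_mult[OF eq w])+
qed

lemma inequality2_iff:
  fixes x a :: real
  assumes x: "0 < x" "x < pi/2"
  shows "3 + (3/20 + 1/280 * x^2 + a * x^4) * x^3 * tan x < 2 * (sin x / x) + tan x / x
      \<longleftrightarrow> a < num2 x / (x^8 * sin x)"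
    and "2 * (sin x / x) + tan x / x < 3 + (3/20 + 1/280 * x^2 + a * x^4) * x^3 * tan x
      \<longleftrightarrow> num2 x / (x^8 * sin x) < a"
proof -
  have s: "0 < sin x" and c: "0 < cos x"
    using x by (auto intro: sin_gt_zero2 cos_gt_zero)
  \<comment> \<open>The parameter now has a plus sign, so \<open>a\<close> and the quotient exchange
    roles.\<close>
  have eq: "2 * (sin x / x) + tan x / x - (3 + (3/20 + 1/280 * x^2 + a * x^4) * x^3 * tan x)
      = (num2 x / (x^8 * sin x) - a) * (x^7 * sin x / cos x)"
    unfolding tan_def num2_def using x(1) s c
    by (simp add: divide_simps) algebra
  have w: "0 < x^7 * sin x / cos x"
    using x(1) s c by simp
  show "3 + (3/20 + 1/280 * x^2 + a * x^4) * x^3 * tan x < 2 * (sin x / x) + tan x / x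
      \<longleftrightarrow> a < num2 x / (x^8 * sin x)"
    and "2 * (sin x / x) + tan x / x < 3 + (3/20 + 1/280 * x^2 + a * x^4) * x^3 * tan x
      \<longleftrightarrow> num2 x / (x^8 * sin x) < a"
    by (rule less_iff_if_diff_eq_mult[OF eq w])+
qed

lemma inequality3_iff:
  fixes x a :: real
  assumes x: "0 < x" "x < pi/2"
  shows "3 + (1/60 - 1/280 * x^2 - a * x^4) * x^3 * tan x < 2 * (x / sin x) + x / tan x
      \<longleftrightarrow> num3 x / (x^7 * sin x^2) < a"
    and "2 * (x / sin x) + x / tan x < 3 + (1/60 - 1/280 * x^2 - a * x^4) * x^3 * tan x
      \<longleftrightarrow> a < num3 x / (x^7 * sin x^2)"
proof -
  have s: "0 < sin x" and c: "0 < cos x"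
    using x by (auto intro: sin_gt_zero2 cos_gt_zero)
  have eq: "2 * (x / sin x) + x / tan x - (3 + (1/60 - 1/280 * x^2 - a * x^4) * x^3 * tan x)
      = (a - num3 x / (x^7 * sin x^2)) * (x^7 * sin x / cos x)"
    unfolding tan_def num3_def using x(1) s c
    by (simp add: divide_simps) algebra
  have w: "0 < x^7 * sin x / cos x"
    using x(1) s c by simp
  show "3 + (1/60 - 1/280 * x^2 - a * x^4) * x^3 * tan x < 2 * (x / sin x) + x / tan x
      \<longleftrightarrow> num3 x / (x^7 * sin x^2) < a"
    and "2 * (x / sin x) + x / tan x < 3 + (1/60 - 1/280 * x^2 - a * x^4) * x^3 * tan x
      \<longleftrightarrow> a < num3 x / (x^7 * sin x^2)"
    by (rule less_iff_if_diff_eq_mult[OF eq w])+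
qed

section \<open>Values and decimals of the constants\<close>

lemma endpoint_values:
  shows "num1 (pi/2) / ((pi/2)^7 * sin (pi/2)^3) = (224 - 8 * pi^2) / (315 * pi^4)"
    and "num2 (pi/2) / ((pi/2)^8 * sin (pi/2)) = (17920 - 168 * pi^4 - pi^6) / (70 * pi^8)"
    and "num3 (pi/2) / ((pi/2)^7 * sin (pi/2)^2) = (56 - 3 * pi^2) / (210 * pi^4)"
  unfolding num1_def num2_def num3_def by (simp_all add: divide_simps power_divide) algebra+

text \<open>With denominators cleared, every bound is linear in the even powers of
  \<open>pi\<close>, so enclosing each power separately is enough.\<close>

lemma constant_bounds:
  shows "0.004727 \<le> (224 - 8 * pi^2) / (315 * pi^4)" "(224 - 8 * pi^2) / (315 * pi^4) < 0.004728"
    and "0.000894 \<le> (17920 - 168 * pi^4 - pi^6) / (70 * pi^8)"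
      "(17920 - 168 * pi^4 - pi^6) / (70 * pi^8) < 0.000895"
    and "0.0012901 \<le> (56 - 3 * pi^2) / (210 * pi^4)" "(56 - 3 * pi^2) / (210 * pi^4) < 0.0012902"
proof -
  have lo: "(2108/671)^n < pi^n" and hi: "pi^n < (355/113)^n" if "0 < n" for n :: nat
    using pi_half_bounds that by (auto intro!: power_strict_mono)
  note bounds = lo[of 2] hi[of 2] lo[of 4] hi[of 4] lo[of 6] hi[of 6] lo[of 8] hi[of 8]
  show "0.004727 \<le> (224 - 8 * pi^2) / (315 * pi^4)" "(224 - 8 * pi^2) / (315 * pi^4) < 0.004728"
    "0.000894 \<le> (17920 - 168 * pi^4 - pi^6) / (70 * pi^8)"
    "(17920 - 168 * pi^4 - pi^6) / (70 * pi^8) < 0.000895"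
    "0.0012901 \<le> (56 - 3 * pi^2) / (210 * pi^4)" "(56 - 3 * pi^2) / (210 * pi^4) < 0.0012902"
    using bounds by (simp_all add: pos_le_divide_eq pos_divide_less_eq power_divide)
qed

section \<open>The three pairs of inequalities\<close>

theorem theorem3p4:
  fixes \<alpha> \<beta> lam \<mu> \<rho> vrho :: real
  assumes alpha: "\<alpha> = (224 - 8 * pi^2) / (315 * pi^4)"
    and beta: "\<beta> = 4 / 1575"
    and lambda: "lam = 23 / 33600"
    and mu: "\<mu> = (17920 - 168 * pi^4 - pi^6) / (70 * pi^8)"
    and rho: "\<rho> = (56 - 3 * pi^2) / (210 * pi^4)"
    and varrho: "vrho = 83 / 100800"
  shows
    "best_possible_below (\<lambda>a. \<forall>x::real. 0 < x \<and> x < pi / 2 \<longrightarrow>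
       2 + (2/45 - 2/315 * x^2 - a * x^4) * x^3 * tan x < (x / sin x)^2 + x / tan x) \<alpha> \<and>
     best_possible_above (\<lambda>b. \<forall>x::real. 0 < x \<and> x < pi / 2 \<longrightarrow>
       (x / sin x)^2 + x / tan x < 2 + (2/45 - 2/315 * x^2 - b * x^4) * x^3 * tan x) \<beta> \<and>
     best_possible_above (\<lambda>l. \<forall>x::real. 0 < x \<and> x < pi / 2 \<longrightarrow>
       3 + (3/20 + 1/280 * x^2 + l * x^4) * x^3 * tan x < 2 * (sin x / x) + tan x / x) lam \<and>
     best_possible_below (\<lambda>m. \<forall>x::real. 0 < x \<and> x < pi / 2 \<longrightarrow>
       2 * (sin x / x) + tan x / x < 3 + (3/20 + 1/280 * x^2 + m * x^4) * x^3 * tan x) \<mu> \<and>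
     best_possible_below (\<lambda>r. \<forall>x::real. 0 < x \<and> x < pi / 2 \<longrightarrow>
       3 + (1/60 - 1/280 * x^2 - r * x^4) * x^3 * tan x < 2 * (x / sin x) + x / tan x) \<rho> \<and>
     best_possible_above (\<lambda>r. \<forall>x::real. 0 < x \<and> x < pi / 2 \<longrightarrow>
       2 * (x / sin x) + x / tan x < 3 + (1/60 - 1/280 * x^2 - r * x^4) * x^3 * tan x) vrho \<and>
     0.004727 \<le> \<alpha> \<and> \<alpha> < 0.004728 \<and>
     0.002539 \<le> \<beta> \<and> \<beta> < 0.002540 \<and>
     0.000684 \<le> lam \<and> lam < 0.000685 \<and>
     0.000894 \<le> \<mu> \<and> \<mu> < 0.000895 \<and>
     0.0012901 \<le> \<rho> \<and> \<rho> < 0.0012902 \<and>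
     0.0008234 \<le> vrho \<and> vrho < 0.0008235"
proof -
  let ?D = "\<lambda>x. 0 < x \<and> x < pi/2"
  \<comment> \<open>Equivalences of the fully quantified statements can rewrite the predicates
    beneath their binders.\<close>
  have iff1: "(\<forall>x. ?D x \<longrightarrow> 2 + (2/45 - 2/315 * x^2 - a * x^4) * x^3 * tan x < (x / sin x)^2 + x / tan x)
      \<longleftrightarrow> (\<forall>x. ?D x \<longrightarrow> num1 x / (x^7 * sin x^3) < a)"
    "(\<forall>x. ?D x \<longrightarrow> (x / sin x)^2 + x / tan x < 2 + (2/45 - 2/315 * x^2 - a * x^4) * x^3 * tan x)
      \<longleftrightarrow> (\<forall>x. ?D x \<longrightarrow> a < num1 x / (x^7 * sin x^3))" for a
    using inequality1_iff by blast+
  have iff2: "(\<forall>x. ?D x \<longrightarrow> 3 + (3/20 + 1/280 * x^2 + a * x^4) * x^3 * tan x < 2 * (sin x / x) + tan x / x)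
      \<longleftrightarrow> (\<forall>x. ?D x \<longrightarrow> a < num2 x / (x^8 * sin x))"
    "(\<forall>x. ?D x \<longrightarrow> 2 * (sin x / x) + tan x / x < 3 + (3/20 + 1/280 * x^2 + a * x^4) * x^3 * tan x)
      \<longleftrightarrow> (\<forall>x. ?D x \<longrightarrow> num2 x / (x^8 * sin x) < a)" for a
    using inequality2_iff by blast+
  have iff3: "(\<forall>x. ?D x \<longrightarrow> 3 + (1/60 - 1/280 * x^2 - a * x^4) * x^3 * tan x < 2 * (x / sin x) + x / tan x)
      \<longleftrightarrow> (\<forall>x. ?D x \<longrightarrow> num3 x / (x^7 * sin x^2) < a)"
    "(\<forall>x. ?D x \<longrightarrow> 2 * (x / sin x) + x / tan x < 3 + (1/60 - 1/280 * x^2 - a * x^4) * x^3 * tan x)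
      \<longleftrightarrow> (\<forall>x. ?D x \<longrightarrow> a < num3 x / (x^7 * sin x^2))" for a
    using inequality3_iff by blast+
  show ?thesis
    unfolding iff1 iff2 iff3 assms
    using best_possible_quotient1 best_possible_quotient2 best_possible_quotient3 constant_bounds
    \<comment> \<open>This rewrites the chained facts, whose upper constants are still quotients
      evaluated at \<open>pi/2\<close>.\<close>
    unfolding endpoint_values by (intro conjI) simp_all
qed

end
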